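(* Let $\Omega\subset\mathbb{R}^n$ ($n\ge2$) be a bounded domain, let $h\in C(\Omega)\cap L^\infty(\Omega)$ with $h\le0$, let $\lambda\in C(\Omega)$ with $\lambda\ge0$, let $0<m<3$, and let $g\in C(\partial\Omega)$ be nonnegative. Let $u,v\in C(\overline\Omega)$ be nonnegative viscosity solutions of \[ \begin{cases}\Delta_\infty w=\lambda(x)w_+^m+h(x)&\text{in }\Omega,\\ w=g&\text{on }\partial\Omega,\end{cases} \] and let $F:=\{x\in\Omega:\lambda(x)=0\}$. If $u=v$ on $F$, then $u=v$ in $\Omega$.
   Context: The infinity Laplacian is $\Delta_\infty w=\langle D^2w\,Dw,Dw\rangle=\sum_{i,j}\partial_i w\,\partial_{ij}w\,\partial_j w$, and $t_+=\max\{t,0\}$. A function $w\in C(\Omega)$ is a viscosity subsolution (resp. supersolution) of $\Delta_\infty w=\lambda w_+^m+h$ in $\Omega$ if, whenever $\varphi\in C^2(\Omega)$ and $w-\varphi$ has a local maximum (resp. minimum) at $x_0\in\Omega$, one has $\Delta_\infty\varphi(x_0)\ge\lambda(x_0)(w(x_0)_+)^m+h(x_0)$ (resp. $\le$). It is a viscosity solution if it is both. The boundary condition is attained pointwise by the continuous function $w\in C(\overline\Omega)$. *)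

theory Defs
  imports "HOL-Analysis.Analysis"
begin

text \<open>
  Partial derivatives are \<open>Df(x)(e\<^sub>i)\<close>, with \<open>Df\<close> the Frechet derivative; they are only used for
  functions that are Frechet differentiable at the point in question.
\<close>

definition pderivative :: "'n::finite \<Rightarrow> (real^'n \<Rightarrow> real) \<Rightarrow> real^'n \<Rightarrow> real" where
  "pderivative i f x = frechet_derivative f (at x) (axis i 1)"

definition grad :: "(real^'n \<Rightarrow> real) \<Rightarrow> real^'n \<Rightarrow> real^'n::finite" where
  "grad f x = (\<chi> i. pderivative i f x)"

definition hess :: "(real^'n \<Rightarrow> real) \<Rightarrow> real^'n \<Rightarrow> real^'n^'n::finite" where
  "hess f x = (\<chi> i j. pderivative i (pderivative j f) x)"

definition C1_on :: "(real^'n::finite) set \<Rightarrow> (real^'n \<Rightarrow> real) \<Rightarrow> bool" where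
  "C1_on \<Omega> f \<longleftrightarrow> f differentiable_on \<Omega> \<and> (\<forall>i. continuous_on \<Omega> (pderivative i f))"

definition C2_on :: "(real^'n::finite) set \<Rightarrow> (real^'n \<Rightarrow> real) \<Rightarrow> bool" where
  "C2_on \<Omega> f \<longleftrightarrow> C1_on \<Omega> f \<and> (\<forall>i. C1_on \<Omega> (pderivative i f))"

definition infinity_laplacian :: "(real^'n::finite \<Rightarrow> real) \<Rightarrow> real^'n \<Rightarrow> real" where
  "infinity_laplacian f x = (hess f x *v grad f x) \<bullet> grad f x"

lemma infinity_laplacian_sum:
  "infinity_laplacian f x =
    (\<Sum>i\<in>UNIV. \<Sum>j\<in>UNIV. pderivative i f x * pderivative i (pderivative j f) x * pderivative j f x)"
  unfolding infinity_laplacian_def inner_vec_def matrix_vector_mult_def grad_def hess_def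
  by (simp add: sum_distrib_left mult.assoc mult.commute mult.left_commute)

definition local_max_at :: "(real^'n::finite \<Rightarrow> real) \<Rightarrow> real^'n \<Rightarrow> bool" where
  "local_max_at f x0 \<longleftrightarrow> (\<forall>\<^sub>F x in nhds x0. f x \<le> f x0)"

definition local_min_at :: "(real^'n::finite \<Rightarrow> real) \<Rightarrow> real^'n \<Rightarrow> bool" where
  "local_min_at f x0 \<longleftrightarrow> (\<forall>\<^sub>F x in nhds x0. f x0 \<le> f x)"

text \<open>
  The equation is \<open>\<Delta>\<^sub>\<infinity> w = a w\<^sub>+\<^sup>m + h\<close> in an open set \<open>\<Omega>\<close>. It is meant for \<open>m > 0\<close>, where
  \<open>0 powr m = 0\<close> is the usual value.
\<close>

definition viscosity_subsolution ::
    "(real^'n::finite) set \<Rightarrow> (real^'n \<Rightarrow> real) \<Rightarrow> real \<Rightarrow> (real^'n \<Rightarrow> real) \<Rightarrow> (real^'n \<Rightarrow> real) \<Rightarrow> bool"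
  where
  "viscosity_subsolution \<Omega> a m h w \<longleftrightarrow>
    continuous_on \<Omega> w \<and>
    (\<forall>\<phi> x0. C2_on \<Omega> \<phi> \<longrightarrow> x0 \<in> \<Omega> \<longrightarrow> local_max_at (\<lambda>x. w x - \<phi> x) x0 \<longrightarrow>
      infinity_laplacian \<phi> x0 \<ge> a x0 * max (w x0) 0 powr m + h x0)"

definition viscosity_supersolution ::
    "(real^'n::finite) set \<Rightarrow> (real^'n \<Rightarrow> real) \<Rightarrow> real \<Rightarrow> (real^'n \<Rightarrow> real) \<Rightarrow> (real^'n \<Rightarrow> real) \<Rightarrow> bool"
  where
  "viscosity_supersolution \<Omega> a m h w \<longleftrightarrow>
    continuous_on \<Omega> w \<and>
    (\<forall>\<phi> x0. C2_on \<Omega> \<phi> \<longrightarrow> x0 \<in> \<Omega> \<longrightarrow> local_min_at (\<lambda>x. w x - \<phi> x) x0 \<longrightarrow>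
      infinity_laplacian \<phi> x0 \<le> a x0 * max (w x0) 0 powr m + h x0)"

definition viscosity_solution ::
    "(real^'n::finite) set \<Rightarrow> (real^'n \<Rightarrow> real) \<Rightarrow> real \<Rightarrow> (real^'n \<Rightarrow> real) \<Rightarrow> (real^'n \<Rightarrow> real) \<Rightarrow> bool"
  where
  "viscosity_solution \<Omega> a m h w \<longleftrightarrow>
    viscosity_subsolution \<Omega> a m h w \<and> viscosity_supersolution \<Omega> a m h w"

definition Linfty_on :: "(real^'n::finite) set \<Rightarrow> (real^'n \<Rightarrow> real) \<Rightarrow> bool" where
  "Linfty_on \<Omega> f \<longleftrightarrow>
    f \<in> borel_measurable (lebesgue_on \<Omega>) \<and> (\<exists>C. AE x in lebesgue_on \<Omega>. \<bar>f x\<bar> \<le> C)"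

end

theory Submission
  imports Defs
begin

text \<open>
  Write \<open>f = a u\<^sub>+\<^sup>m + h\<close> and \<open>g = a v\<^sub>+\<^sup>m + h\<close>. Wherever \<open>u > v \<ge> 0\<close>, the coefficient \<open>a\<close> cannot
  vanish, because \<open>u = v\<close> on its zero set, so \<open>f > g\<close> there. Uniqueness thus follows from a strict
  comparison principle: if \<open>\<Delta>\<^sub>\<infinity> u \<ge> f\<close> and \<open>\<Delta>\<^sub>\<infinity> v \<le> g\<close> in the viscosity sense, \<open>f > g\<close> wherever
  \<open>u > v\<close>, and \<open>u \<le> v\<close> on the boundary, then \<open>u \<le> v\<close> (\<open>radial_comparison_principle\<close>).

  The comparison principle is proved without the theorem on sums, by a finite difference argument
  in the manner of Armstrong and Smart. If \<open>u > v\<close> somewhere, maximize \<open>u(y) - v(z)\<close> over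
  \<open>|y - z| \<le> 2 e\<close>. As \<open>e\<close> tends to \<open>0\<close> the maximizing pairs accumulate at a point of \<open>\<Omega>\<close> where
  \<open>u > v\<close>, hence \<open>f > g\<close>. There \<open>f > 0\<close> or \<open>g < 0\<close>, and replacing \<open>(u, v)\<close> by \<open>(-v, -u)\<close>
  exchanges these cases, so let \<open>f > 0\<close>. Let \<open>x\<close> be the midpoint of \<open>y\<close> and \<open>z\<close>, let
  \<open>U\<close> be the maximum of \<open>u\<close> and \<open>V\<close> the minimum of \<open>v\<close> over the ball of radius \<open>2 e\<close> about \<open>x\<close>, and put
  \<open>P = u(y) - u(x)\<close>, \<open>Q = U - u(y)\<close>, \<open>P' = v(x) - v(z)\<close>, \<open>Q' = v(z) - V\<close>. Maximality of the pair
  gives \<open>Q \<le> P'\<close> and \<open>Q' \<le> P\<close>.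

  On the other hand, for \<open>H(r) = k \<theta>(r + s)\<close> with \<open>\<theta>(t) = 3/4 t\<^bsup>4/3\<^esup>\<close> one has
  \<open>H'\<^sup>2 H'' = k\<^sup>3/3\<close>, which is the infinity Laplacian of \<open>p \<mapsto> H(|p - x|)\<close>. Comparing \<open>u\<close> with
  such functions on the ball bounds \<open>P\<close> above and \<open>Q\<close> below by increments of \<open>k \<theta>(\<cdot> + s)\<close>; comparing
  \<open>-v\<close> with the reversed functions \<open>-l \<theta>(R + t - r)\<close> bounds \<open>P'\<close> above and \<open>Q'\<close> below by
  increments of \<open>l \<theta>(\<cdot> + t)\<close>. Since \<open>f > g\<close> allows \<open>l < k\<close>, the four bounds are
  incompatible with \<open>Q \<le> P'\<close> and \<open>Q' \<le> P\<close>: they would make the difference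
  \<open>l \<theta>(\<cdot> + t) - k \<theta>(\<cdot> + s)\<close> turn from decreasing to increasing, whereas for \<open>l < k\<close> it can only turn
  from increasing to decreasing (\<open>aronsson_profile_increments_incompatible\<close>). The shift \<open>s \<ge> 0\<close> exists because
  \<open>\<Delta>\<^sub>\<infinity> u > k\<^sup>3/3 > 0\<close> forces \<open>u\<close> to grow by at least \<open>k \<theta>(2 e)\<close>
  (\<open>radial_subsolution_nondegenerate\<close>).
\<close>

section \<open>Radial test functions\<close>

text \<open>
  The inequality \<open>\<Delta>\<^sub>\<infinity> w \<ge> f\<close> in \<open>\<Omega>\<close>, tested only with the radial quartics
  \<open>\<phi>(p) = B |p - x|\<^sup>2 + C |p - x|\<^sup>4\<close> about arbitrary centres \<open>x\<close>. The right-hand side is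
  \<open>\<Delta>\<^sub>\<infinity> \<phi>(x0)\<close> written out. Quartics are smooth on the whole space, so no cut-off is needed, and
  they can match any radial function to first order away from its centre, with prescribed second
  radial derivative. The infinity Laplacian being odd, \<open>\<Delta>\<^sub>\<infinity> w \<le> g\<close> is expressed
  as \<open>radial_subsolution \<Omega> (- g) (- w)\<close>.
\<close>
definition radial_subsolution :: "(real^'n::finite) set \<Rightarrow> (real^'n \<Rightarrow> real) \<Rightarrow> (real^'n \<Rightarrow> real) \<Rightarrow> bool" where
  "radial_subsolution \<Omega> f w \<longleftrightarrow>
    (\<forall>x0\<in>\<Omega>. \<forall>x B C. local_max_at (\<lambda>p. w p - (B * norm (p - x) ^ 2 + C * norm (p - x) ^ 4)) x0 \<longrightarrow>
      f x0 \<le> (let t = norm (x0 - x) ^ 2; b = B + 2 * C * t in 8 * b ^ 3 * t + 32 * b ^ 2 * C * t ^ 2))"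

lemma norm4_inner: "norm (p::'a::real_inner) ^ 4 = (p \<bullet> p) ^ 2"
  by (simp add: power2_norm_eq_inner[symmetric] flip: power_mult)

lemma pderivative_eq:
  assumes "(f has_derivative f') (at x)"
  shows "pderivative i f x = f' (axis i 1)"
  using assms unfolding pderivative_def by (metis frechet_derivative_at)

lemma pderivative_quartic:
  fixes c :: "real^'n::finite"
  shows "pderivative i (\<lambda>p. B * norm (p - c) ^ 2 + C * norm (p - c) ^ 4)
    = (\<lambda>p. 2 * (B + 2 * C * ((p - c) \<bullet> (p - c))) * (p $ i - c $ i))"
proof
  fix p :: "real^'n"
  have "((\<lambda>p. B * norm (p - c) ^ 2 + C * norm (p - c) ^ 4) has_derivative
      (\<lambda>h. 2 * (B + 2 * C * ((p - c) \<bullet> (p - c))) * ((p - c) \<bullet> h))) (at p)"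
    unfolding norm4_inner power2_norm_eq_inner
    by (auto intro!: derivative_eq_intros simp: inner_commute algebra_simps power2_eq_square)
  from pderivative_eq[OF this, of i]
  show "pderivative i (\<lambda>p. B * norm (p - c) ^ 2 + C * norm (p - c) ^ 4) p
    = 2 * (B + 2 * C * ((p - c) \<bullet> (p - c))) * (p $ i - c $ i)"
    by (simp add: inner_axis)
qed

lemma has_derivative_quartic_pderivative:
  fixes c :: "real^'n::finite"
  shows "((\<lambda>p. 2 * (B + 2 * C * ((p - c) \<bullet> (p - c))) * (p $ i - c $ i)) has_derivative
    (\<lambda>h. 8 * C * ((p - c) \<bullet> h) * (p $ i - c $ i) + 2 * (B + 2 * C * ((p - c) \<bullet> (p - c))) * h $ i)) (at p)"
  by (auto intro!: derivative_eq_intros bounded_linear_imp_has_derivative simp: inner_commute algebra_simps)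

lemma pderivative2_quartic:
  fixes c :: "real^'n::finite"
  shows "pderivative j (pderivative i (\<lambda>p. B * norm (p - c) ^ 2 + C * norm (p - c) ^ 4))
    = (\<lambda>p. 8 * C * (p $ j - c $ j) * (p $ i - c $ i)
         + 2 * (B + 2 * C * ((p - c) \<bullet> (p - c))) * (if i = j then 1 else 0))"
proof
  fix p :: "real^'n"
  show "pderivative j (pderivative i (\<lambda>p. B * norm (p - c) ^ 2 + C * norm (p - c) ^ 4)) p
    = 8 * C * (p $ j - c $ j) * (p $ i - c $ i)
         + 2 * (B + 2 * C * ((p - c) \<bullet> (p - c))) * (if i = j then 1 else 0)"
    unfolding pderivative_quartic
    by (subst pderivative_eq[OF has_derivative_quartic_pderivative])
       (auto simp: inner_axis, auto simp: axis_def)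
qed

lemma C2_on_quartic:
  fixes c :: "real^'n::finite"
  shows "C2_on S (\<lambda>p. B * norm (p - c) ^ 2 + C * norm (p - c) ^ 4)"
proof -
  have d1: "(\<lambda>p. B * norm (p - c) ^ 2 + C * norm (p - c) ^ 4) differentiable_on S"
    unfolding norm4_inner power2_norm_eq_inner differentiable_on_def
    by (auto intro!: derivative_intros)
  have d2: "(\<lambda>p. 2 * (B + 2 * C * ((p - c) \<bullet> (p - c))) * (p $ i - c $ i)) differentiable_on S" for i
    using has_derivative_at_withinI[OF has_derivative_quartic_pderivative]
    unfolding differentiable_on_def differentiable_def by blast
  show ?thesis
    unfolding C2_on_def C1_on_def pderivative2_quartic
    unfolding pderivative_quartic
    by (intro conjI allI d1 d2) (auto intro!: continuous_intros)
qed

lemma infinity_laplacian_quartic: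
  fixes c x :: "real^'n::finite"
    and B C :: real
  defines "t \<equiv> norm (x - c) ^ 2"
  defines "b \<equiv> B + 2 * C * t"
  shows "infinity_laplacian (\<lambda>p. B * norm (p - c) ^ 2 + C * norm (p - c) ^ 4) x
    = 8 * b ^ 3 * t + 32 * b ^ 2 * C * t ^ 2"
proof -
  define z where "z = x - c"
  have zi: "x $ i - c $ i = z $ i" for i by (simp add: z_def)
  have t: "t = z \<bullet> z" by (simp add: t_def z_def power2_norm_eq_inner)
  have ts: "(\<Sum>i\<in>UNIV. z $ i * z $ i) = t" by (simp add: t inner_vec_def)
  have g: "grad (\<lambda>p. B * norm (p - c) ^ 2 + C * norm (p - c) ^ 4) x = (2 * b) *\<^sub>R z"
    by (simp add: grad_def pderivative_quartic vec_eq_iff zi b_def t flip: z_def)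
  have "hess (\<lambda>p. B * norm (p - c) ^ 2 + C * norm (p - c) ^ 4) x *v ((2 * b) *\<^sub>R z)
      = (16 * C * b * t + 4 * b ^ 2) *\<^sub>R z"
  proof -
    have "(\<Sum>j\<in>UNIV. (8 * C * z $ i * z $ j + 2 * b * (if j = i then 1 else 0)) * (2 * b * z $ j))
        = (16 * C * b * t + 4 * b ^ 2) * z $ i" for i
    proof -
      have "(\<Sum>j\<in>UNIV. (8 * C * z $ i * z $ j + 2 * b * (if j = i then 1 else 0)) * (2 * b * z $ j))
        = (\<Sum>j\<in>UNIV. (16 * C * b * z $ i) * (z $ j * z $ j) + (if j = i then 4 * b ^ 2 * z $ j else 0))"
        by (intro sum.cong) (auto simp: algebra_simps power2_eq_square)
      also have "\<dots> = (16 * C * b * z $ i) * t + 4 * b ^ 2 * z $ i"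
        by (simp add: sum.distrib sum_distrib_left[symmetric] ts)
      finally show ?thesis by (simp add: algebra_simps)
    qed
    then show ?thesis
      by (simp add: hess_def pderivative2_quartic matrix_vector_mult_def vec_eq_iff zi b_def t flip: z_def)
  qed
  then show ?thesis
    unfolding infinity_laplacian_def g
    by (simp add: t[symmetric] algebra_simps power2_eq_square power3_eq_cube)
qed

lemma viscosity_subsolution_imp_radial:
  assumes "viscosity_subsolution \<Omega> a m h w"
  shows "radial_subsolution \<Omega> (\<lambda>x. a x * max (w x) 0 powr m + h x) w"
  unfolding radial_subsolution_def Let_def infinity_laplacian_quartic[symmetric]
  using assms C2_on_quartic unfolding viscosity_subsolution_def by blast

lemma viscosity_supersolution_imp_radial:
  assumes "viscosity_supersolution \<Omega> a m h w"
  shows "radial_subsolution \<Omega> (\<lambda>x. - (a x * max (w x) 0 powr m + h x)) (\<lambda>x. - w x)"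
  unfolding radial_subsolution_def Let_def
proof (intro ballI allI impI)
  fix x0 x :: "real^'a" and B C :: real
  assume x0: "x0 \<in> \<Omega>"
    and max: "local_max_at (\<lambda>p. - w p - (B * norm (p - x) ^ 2 + C * norm (p - x) ^ 4)) x0"
  have "local_min_at (\<lambda>p. w p - ((- B) * norm (p - x) ^ 2 + (- C) * norm (p - x) ^ 4)) x0"
    using max unfolding local_max_at_def local_min_at_def
    by (rule eventually_mono) (simp add: algebra_simps)
  then have "infinity_laplacian (\<lambda>p. (- B) * norm (p - x) ^ 2 + (- C) * norm (p - x) ^ 4) x0
      \<le> a x0 * max (w x0) 0 powr m + h x0"
    using assms x0 C2_on_quartic[of \<Omega> "- B" x "- C"]
    unfolding viscosity_supersolution_def by blast
  then show "- (a x0 * max (w x0) 0 powr m + h x0)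
      \<le> 8 * (B + 2 * C * norm (x0 - x) ^ 2) ^ 3 * norm (x0 - x) ^ 2
        + 32 * (B + 2 * C * norm (x0 - x) ^ 2) ^ 2 * C * (norm (x0 - x) ^ 2) ^ 2"
    unfolding infinity_laplacian_quartic
    by (simp add: algebra_simps power2_eq_square power3_eq_cube)
qed

lemma local_min_second_derivative:
  fixes D :: "real \<Rightarrow> real"
  assumes D: "\<forall>\<^sub>F r in nhds a. (D has_real_derivative D1 r) (at r)"
    and D1: "(D1 has_real_derivative d) (at a)" and "D1 a = 0" "d > 0"
  shows "\<forall>\<^sub>F r in nhds a. D a \<le> D r"
proof -
  obtain e0 where e0: "e0 > 0" "\<And>r. \<bar>r - a\<bar> < e0 \<Longrightarrow> (D has_real_derivative D1 r) (at r)"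
    using D unfolding eventually_nhds_metric by (auto simp: dist_real_def)
  obtain e1 where e1: "e1 > 0" "\<And>h. 0 < h \<Longrightarrow> h < e1 \<Longrightarrow> D1 a < D1 (a + h)"
    using DERIV_pos_inc_right[OF D1 \<open>d > 0\<close>] by auto
  obtain e2 where e2: "e2 > 0" "\<And>h. 0 < h \<Longrightarrow> h < e2 \<Longrightarrow> D1 (a - h) < D1 a"
    using DERIV_pos_inc_left[OF D1 \<open>d > 0\<close>] by auto
  define e where "e = Min {e0, e1, e2}"
  have e: "e > 0" "e \<le> e0" "e \<le> e1" "e \<le> e2" using e0 e1 e2 by (auto simp: e_def)
  have "D a \<le> D r" if "\<bar>r - a\<bar> < e" for r
  proof (cases r a rule: linorder_cases)
    case less
    have "\<exists>z>r. z < a \<and> D a - D r = (a - r) * D1 z"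
      using less e that by (intro MVT2 e0(2)) auto
    then obtain z where z: "r < z" "z < a" "D a - D r = (a - r) * D1 z" by blast
    have "D1 z < 0" using e2(2)[of "a - z"] z that e assms(3) by auto
    then have "(a - r) * D1 z \<le> 0" using less by (simp add: mult_nonneg_nonpos)
    then show ?thesis using z by linarith
  next
    case greater
    have "\<exists>z>a. z < r \<and> D r - D a = (r - a) * D1 z"
      using greater e that by (intro MVT2 e0(2)) auto
    then obtain z where z: "a < z" "z < r" "D r - D a = (r - a) * D1 z" by blast
    have "D1 z > 0" using e1(2)[of "z - a"] z that e assms(3) by auto
    then have "(r - a) * D1 z \<ge> 0" using greater by simp
    then show ?thesis using z by linarith
  qed auto
  then show ?thesis using e(1) unfolding eventually_nhds_metric dist_real_def by blast
qed

text \<open>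
  Arbitrary radial test functions are admissible: the infinity Laplacian of \<open>p \<mapsto> H(|p - x|)\<close> is
  \<open>H'\<^sup>2 H''\<close> away from \<open>x\<close>.
\<close>
lemma radial_test:
  fixes x :: "real^'n::finite"
  assumes sub: "radial_subsolution \<Omega> f w" and "x0 \<in> \<Omega>" "x0 \<noteq> x"
    and max: "local_max_at (\<lambda>p. w p - H (norm (p - x))) x0"
    and H: "\<forall>\<^sub>F r in nhds (norm (x0 - x)). (H has_real_derivative H1 r) (at r)"
    and H1: "(H1 has_real_derivative h2) (at (norm (x0 - x)))"
  shows "f x0 \<le> (H1 (norm (x0 - x)))\<^sup>2 * h2"
proof -
  define r0 where "r0 = norm (x0 - x)"
  define h1 where "h1 = H1 r0"
  have r0: "r0 > 0" using \<open>x0 \<noteq> x\<close> by (simp add: r0_def)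
  have *: "f x0 \<le> h1\<^sup>2 * (h2 + e)" if "e > 0" for e
  proof -
    \<comment> \<open>The quartic matches \<open>H\<close> to first order at \<open>r0\<close>, with second derivative larger by \<open>e\<close>.\<close>
    define C where "C = (h2 + e - h1 / r0) / (8 * r0 ^ 2)"
    define B where "B = h1 / (2 * r0) - 2 * C * r0 ^ 2"
    define D where "D = (\<lambda>r. B * r ^ 2 + C * r ^ 4 - H r)"
    define D1 where "D1 = (\<lambda>r. 2 * B * r + 4 * C * r ^ 3 - H1 r)"
    have dD: "\<forall>\<^sub>F r in nhds r0. (D has_real_derivative D1 r) (at r)"
      using H unfolding r0_def[symmetric] D_def D1_def
      by (rule eventually_mono) (auto intro!: derivative_eq_intros)
    have CC: "C * (8 * r0 ^ 2) = h2 + e - h1 / r0" using r0 by (simp add: C_def)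
    have BB: "B + 2 * C * r0 ^ 2 = h1 / (2 * r0)" by (simp add: B_def)
    have "D1 r0 = 2 * r0 * (B + 2 * C * r0 ^ 2) - h1"
      by (simp add: D1_def h1_def algebra_simps power2_eq_square power3_eq_cube)
    also have "\<dots> = 0" unfolding BB using r0 by simp
    finally have D10: "D1 r0 = 0" .
    have "(D1 has_real_derivative 2 * B + 12 * C * r0 ^ 2 - h2) (at r0)"
      using H1 unfolding r0_def[symmetric] D1_def by (auto intro!: derivative_eq_intros)
    moreover have "2 * B + 12 * C * r0 ^ 2 - h2 = e"
    proof -
      have "2 * B + 12 * C * r0 ^ 2 - h2 = 2 * (B + 2 * C * r0 ^ 2) + C * (8 * r0 ^ 2) - h2"
        by (simp add: algebra_simps)
      also have "\<dots> = e" unfolding BB CC using r0 by (simp add: field_simps)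
      finally show ?thesis .
    qed
    ultimately have "(D1 has_real_derivative e) (at r0)" by simp
    from local_min_second_derivative[OF dD this D10 \<open>e > 0\<close>]
    have ev: "\<forall>\<^sub>F r in nhds r0. D r0 \<le> D r" .
    have "((\<lambda>p. norm (p - x)) \<longlongrightarrow> r0) (nhds x0)"
      unfolding r0_def by (intro tendsto_intros filterlim_ident)
    from eventually_compose_filterlim[OF ev this]
    have ev': "\<forall>\<^sub>F p in nhds x0. D r0 \<le> D (norm (p - x))" .
    have "local_max_at (\<lambda>p. w p - (B * norm (p - x) ^ 2 + C * norm (p - x) ^ 4)) x0"
      using max ev' unfolding local_max_at_def
      by eventually_elim (auto simp: D_def r0_def)
    then have "f x0 \<le> 8 * (B + 2 * C * r0 ^ 2) ^ 3 * r0 ^ 2 + 32 * (B + 2 * C * r0 ^ 2) ^ 2 * C * (r0 ^ 2) ^ 2"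
      using sub \<open>x0 \<in> \<Omega>\<close> unfolding radial_subsolution_def Let_def r0_def by blast
    also have "\<dots> = 8 * (h1 / (2 * r0)) ^ 3 * r0 ^ 2 + 4 * (h1 / (2 * r0)) ^ 2 * (C * (8 * r0 ^ 2)) * r0 ^ 2"
      unfolding BB by (simp add: power2_eq_square)
    also have "\<dots> = h1\<^sup>2 * (h2 + e)"
      unfolding CC using r0 by (simp add: divide_simps) (simp add: algebra_simps power2_eq_square power3_eq_cube)
    finally show ?thesis .
  qed
  have "((\<lambda>e. h1\<^sup>2 * (h2 + e)) \<longlongrightarrow> h1\<^sup>2 * (h2 + 0)) (at_right 0)"
    by (intro tendsto_intros)
  then have "f x0 \<le> h1\<^sup>2 * (h2 + 0)"
    by (rule tendsto_lowerbound)
       (use * in \<open>auto simp: eventually_at_right_field intro!: exI[of _ 1]\<close>)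
  then show ?thesis by (simp add: h1_def r0_def)
qed

text \<open>
  Comparison on a ball with a radial strict supersolution that is smooth except at the centre: the
  maximum of the difference is attained at the centre or on the bounding sphere.
\<close>
lemma radial_comparison:
  fixes x :: "real^'n::finite"
  assumes sub: "radial_subsolution \<Omega> f w" and cont: "continuous_on \<Omega> w"
    and ball: "cball x R \<subseteq> \<Omega>" and "R > 0"
    and Hcont: "continuous_on {0..R} H"
    and H: "\<And>r. 0 < r \<Longrightarrow> r < R \<Longrightarrow> (H has_real_derivative H1 r) (at r)"
    and H1: "\<And>r. 0 < r \<Longrightarrow> r < R \<Longrightarrow> (H1 has_real_derivative H2 r) (at r)"
    and less: "\<And>p. p \<in> cball x R \<Longrightarrow> 0 < norm (p - x) \<Longrightarrow> norm (p - x) < R \<Longrightarrow>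
      (H1 (norm (p - x)))\<^sup>2 * H2 (norm (p - x)) < f p"
    and centre: "w x - H 0 \<le> K"
    and sphere: "\<And>p. norm (p - x) = R \<Longrightarrow> w p - H R \<le> K"
    and p: "p \<in> cball x R"
  shows "w p - H (norm (p - x)) \<le> K"
proof -
  let ?F = "\<lambda>p. w p - H (norm (p - x))"
  have "continuous_on (cball x R) ?F"
    by (intro continuous_intros continuous_on_subset[OF cont ball] continuous_on_compose2[OF Hcont])
       (auto simp: dist_norm norm_minus_commute)
  then obtain q where q: "q \<in> cball x R" "\<And>y. y \<in> cball x R \<Longrightarrow> ?F y \<le> ?F q"
    using continuous_attains_sup[OF compact_cball _ \<open>continuous_on (cball x R) ?F\<close>] p by blast
  have qR: "norm (q - x) \<le> R" using q by (simp add: dist_norm norm_minus_commute)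
  have "?F q \<le> K"
  proof (cases "q = x \<or> norm (q - x) = R")
    case True
    then show ?thesis using centre sphere by auto
  next
    case False
    then have r: "0 < norm (q - x)" "norm (q - x) < R" using qR by auto
    have "q \<in> ball x R" using r by (simp add: dist_norm norm_minus_commute)
    then have "\<forall>\<^sub>F y in nhds q. y \<in> ball x R" by (intro eventually_nhds_in_open) auto
    then have max: "local_max_at ?F q" unfolding local_max_at_def
      by (rule eventually_mono) (use q(2) in auto)
    have "\<forall>\<^sub>F r in nhds (norm (q - x)). r \<in> {0<..<R}"
      using r by (intro eventually_nhds_in_open) auto
    then have "\<forall>\<^sub>F r in nhds (norm (q - x)). (H has_real_derivative H1 r) (at r)"
      by (rule eventually_mono) (use H in auto)
    from radial_test[OF sub _ _ max this H1[OF r]] q(1) ball False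
    have "f q \<le> (H1 (norm (q - x)))\<^sup>2 * H2 (norm (q - x))" by auto
    then show ?thesis using less[OF q(1) r] by simp
  qed
  then show ?thesis using q(2)[OF p] by simp
qed

section \<open>The profile with exponent 4/3\<close>

text \<open>
  The solution \<open>\<theta>(t) = 3/4 t\<^bsup>4/3\<^esup>\<close> of \<open>\<theta>'\<^sup>2 \<theta>'' = 1/3\<close> for \<open>t > 0\<close>; only arguments \<open>t \<ge> 0\<close> occur.
\<close>
definition aronsson_profile :: "real \<Rightarrow> real" where
  "aronsson_profile t = 3 / 4 * t powr (4 / 3)"

lemma aronsson_profile_0 [simp]: "aronsson_profile 0 = 0"
  by (simp add: aronsson_profile_def)

lemma aronsson_profile_mono: "0 \<le> s \<Longrightarrow> s \<le> t \<Longrightarrow> aronsson_profile s \<le> aronsson_profile t"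
  by (simp add: aronsson_profile_def powr_mono2)

lemma aronsson_profile_strict_mono: "0 \<le> s \<Longrightarrow> s < t \<Longrightarrow> aronsson_profile s < aronsson_profile t"
  by (simp add: aronsson_profile_def powr_less_mono2)

lemma has_derivative_aronsson_profile:
  assumes "t > 0"
  shows "(aronsson_profile has_real_derivative t powr (1 / 3)) (at t)"
  unfolding aronsson_profile_def[abs_def]
  using assms by (auto intro!: derivative_eq_intros)

lemma has_derivative_aronsson_profile_deriv:
  fixes t :: real
  assumes "t > 0"
  shows "((\<lambda>t. t powr (1 / 3)) has_real_derivative 1 / 3 * t powr (- 2 / 3)) (at t)"
  using has_real_derivative_powr[OF assms, of "1 / 3"] by simp

lemma continuous_on_aronsson_profile: "continuous_on {0..} aronsson_profile"
  unfolding aronsson_profile_def[abs_def] by (intro continuous_intros continuous_on_powr') auto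

text \<open>
  The equation \<open>H'\<^sup>2 H'' = k\<^sup>3/3\<close> for \<open>H = k \<theta>\<close>.
\<close>
lemma aronsson_profile_ode:
  fixes t k :: real
  assumes "t > 0"
  shows "(k * t powr (1 / 3))\<^sup>2 * (k * (1 / 3 * t powr (- 2 / 3))) = k ^ 3 / 3"
proof -
  have "(t powr (1 / 3))\<^sup>2 * t powr (- 2 / 3) = 1"
    using assms by (simp add: power2_eq_square powr_add[symmetric])
  then have "k ^ 3 / 3 = k ^ 3 / 3 * ((t powr (1 / 3))\<^sup>2 * t powr (- 2 / 3))" by simp
  then show ?thesis by (simp add: power2_eq_square power3_eq_cube mult.assoc)
qed

lemma mean_value_real_derivative:
  fixes f :: "real \<Rightarrow> real"
  assumes "a < b" "continuous_on {a..b} f"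
    and f': "\<And>z. a < z \<Longrightarrow> z < b \<Longrightarrow> (f has_real_derivative f' z) (at z)"
  obtains z where "a < z" "z < b" "f b - f a = (b - a) * f' z"
proof -
  obtain l z where "a < z" "z < b" "DERIV f z :> l" "f b - f a = (b - a) * l"
    using MVT[OF assms(1,2)] f' by (meson real_differentiable_def)
  then show ?thesis using that f' DERIV_unique by blast
qed

lemma aronsson_profile_increment_mono:
  assumes "0 \<le> d" "0 \<le> s" "s \<le> t"
  shows "aronsson_profile (s + d) - aronsson_profile s \<le> aronsson_profile (t + d) - aronsson_profile t"
proof (cases "s = t")
  case False
  have "continuous_on {s..t} (\<lambda>z. aronsson_profile (z + d) - aronsson_profile z)"
    using assms
    by (intro continuous_intros continuous_on_compose2[OF continuous_on_aronsson_profile]) auto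
  moreover have "((\<lambda>z. aronsson_profile (z + d) - aronsson_profile z) has_real_derivative
       ((z + d) powr (1/3) - z powr (1/3))) (at z)" if "s < z" "z < t" for z
    using that assms has_derivative_aronsson_profile[of z] has_derivative_aronsson_profile[of "z + d"]
    by (auto intro!: derivative_eq_intros DERIV_chain2[where f=aronsson_profile])
  ultimately obtain z where z: "z > s" "(aronsson_profile (t + d) - aronsson_profile t)
      - (aronsson_profile (s + d) - aronsson_profile s) = (t - s) * ((z + d) powr (1/3) - z powr (1/3))"
    using mean_value_real_derivative[of s t "\<lambda>z. aronsson_profile (z + d) - aronsson_profile z"
        "\<lambda>z. (z + d) powr (1/3) - z powr (1/3)" thesis] False assms by fastforce
  have "(z + d) powr (1/3) \<ge> z powr (1/3)" using assms z by (intro powr_mono2) auto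
  then have "(t - s) * ((z + d) powr (1/3) - z powr (1/3)) \<ge> 0"
    using assms by (intro mult_nonneg_nonneg) auto
  with z(2) show ?thesis by linarith
qed simp

lemma aronsson_profile_increment_surj:
  assumes "k > 0" "d > 0" "T \<ge> k * aronsson_profile d"
  obtains s where "s \<ge> 0" "T = k * (aronsson_profile (d + s) - aronsson_profile s)"
proof -
  have "filterlim (\<lambda>s. (d + s) powr (4/3) - s powr (4/3)) at_top at_top"
    using assms(2) by real_asymp
  then have "filterlim (\<lambda>s. (k * (3/4)) * ((d + s) powr (4/3) - s powr (4/3))) at_top at_top"
    using assms(1) by (intro filterlim_tendsto_pos_mult_at_top[OF tendsto_const]) auto
  then have "\<forall>\<^sub>F s in at_top. (k * (3/4)) * ((d + s) powr (4/3) - s powr (4/3)) \<ge> T"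
    by (auto simp: filterlim_at_top)
  then have "\<forall>\<^sub>F s in at_top. s \<ge> 0 \<and> k * (aronsson_profile (d + s) - aronsson_profile s) \<ge> T"
    using eventually_ge_at_top[of 0]
    by eventually_elim (simp add: aronsson_profile_def algebra_simps)
  then obtain S where S: "S \<ge> 0" "k * (aronsson_profile (d + S) - aronsson_profile S) \<ge> T"
    by (auto simp: eventually_at_top_linorder)
  have "\<exists>s\<ge>0. s \<le> S \<and> k * (aronsson_profile (d + s) - aronsson_profile s) = T"
    using assms S
    by (intro IVT' continuous_intros continuous_on_compose2[OF continuous_on_aronsson_profile]) auto
  then show ?thesis using that by metis
qed

text \<open>
  With \<open>D(r) = l \<theta>(r + t) - k \<theta>(r + s)\<close>, the two inequalities say that \<open>D(e) \<le> D(0)\<close>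
  and \<open>D(2e) \<ge> D(e)\<close>, so \<open>D' \<le> 0\<close> somewhere in \<open>(0, e)\<close> and \<open>D' \<ge> 0\<close> somewhere in \<open>(e, 2e)\<close>. But \<open>D'\<close> has the sign of
  \<open>l\<^sup>3 (r + t) - k\<^sup>3 (r + s)\<close>, which is strictly decreasing in \<open>r\<close>.
\<close>
lemma aronsson_profile_increments_incompatible:
  assumes "0 < l" "l < k" "0 < e" "0 \<le> s" "0 \<le> t"
    and inner: "l * (aronsson_profile (e + t) - aronsson_profile t)
      \<le> k * (aronsson_profile (e + s) - aronsson_profile s)"
    and outer: "k * (aronsson_profile (2 * e + s) - aronsson_profile (e + s))
      \<le> l * (aronsson_profile (2 * e + t) - aronsson_profile (e + t))"
  shows False
proof -
  define D where "D = (\<lambda>r. l * aronsson_profile (r + t) - k * aronsson_profile (r + s))"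
  define D1 where "D1 = (\<lambda>r. l * (r + t) powr (1/3) - k * (r + s) powr (1/3))"
  have cont: "continuous_on {a..b} D" if "0 \<le> a" for a b
    unfolding D_def using assms that
    by (intro continuous_intros continuous_on_compose2[OF continuous_on_aronsson_profile]) auto
  have der: "(D has_real_derivative D1 r) (at r)" if "0 < r" for r
    unfolding D_def D1_def
    using that assms has_derivative_aronsson_profile[of "r + s"] has_derivative_aronsson_profile[of "r + t"]
    by (auto intro!: derivative_eq_intros DERIV_chain2[where f=aronsson_profile])
  have mvt: "\<exists>r>a. r < b \<and> D b - D a = (b - a) * D1 r" if ab: "0 \<le> a" "a < b" for a b
  proof (rule mean_value_real_derivative[OF \<open>a < b\<close> cont[OF \<open>0 \<le> a\<close>]])
    show "(D has_real_derivative D1 z) (at z)" if "a < z" for z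
      using der that ab by simp
  qed blast
  have cube: "(c * t powr (1/3)) ^ 3 = c ^ 3 * t" if "t > 0" for c t :: real
    using that by (simp add: power_mult_distrib powr_power)
  obtain r1 where r1: "0 < r1" "r1 < e" "D e - D 0 = (e - 0) * D1 r1" using mvt[of 0 e] assms by auto
  obtain r2 where r2: "e < r2" "D (2*e) - D e = (2*e - e) * D1 r2" using mvt[of e "2*e"] assms by auto
  have "D e - D 0 \<le> 0" using inner by (simp add: D_def algebra_simps)
  then have "D1 r1 \<le> 0" using r1 assms by (simp add: mult_le_0_iff)
  then have "(l * (r1 + t) powr (1/3)) ^ 3 \<le> (k * (r1 + s) powr (1/3)) ^ 3"
    using assms by (intro power_mono) (auto simp: D1_def)
  then have 1: "l ^ 3 * (r1 + t) \<le> k ^ 3 * (r1 + s)" using r1 assms by (simp add: cube)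
  have "D (2*e) - D e \<ge> 0" using outer by (simp add: D_def algebra_simps)
  then have "D1 r2 \<ge> 0" using r2 assms by (simp add: zero_le_mult_iff)
  then have "(k * (r2 + s) powr (1/3)) ^ 3 \<le> (l * (r2 + t) powr (1/3)) ^ 3"
    using assms by (intro power_mono) (auto simp: D1_def)
  then have 2: "k ^ 3 * (r2 + s) \<le> l ^ 3 * (r2 + t)" using r1 r2 assms by (simp add: cube)
  have "k ^ 3 * (r2 - r1) \<le> l ^ 3 * (r2 - r1)" using 1 2 by (simp add: algebra_simps)
  moreover have "l ^ 3 < k ^ 3" using assms by (intro power_strict_mono) auto
  ultimately show False using r1 r2 by (simp add: mult_le_cancel_right)
qed

section \<open>Radial subsolutions and the profile\<close>

lemma has_derivative_scaled_profile:
  assumes "0 < r + s"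
  shows "((\<lambda>r. k * aronsson_profile (r + s)) has_real_derivative k * (r + s) powr (1 / 3)) (at r)"
    and "((\<lambda>r. k * (r + s) powr (1 / 3)) has_real_derivative k * (1 / 3 * (r + s) powr (- 2 / 3))) (at r)"
proof -
  show "((\<lambda>r. k * aronsson_profile (r + s)) has_real_derivative k * (r + s) powr (1 / 3)) (at r)"
    using DERIV_shift[THEN iffD1, OF has_derivative_aronsson_profile[OF assms]]
    by (rule DERIV_cmult)
  show "((\<lambda>r. k * (r + s) powr (1 / 3)) has_real_derivative k * (1 / 3 * (r + s) powr (- 2 / 3))) (at r)"
    using DERIV_shift[THEN iffD1, OF has_derivative_aronsson_profile_deriv[OF assms]]
    by (rule DERIV_cmult)
qed

text \<open>
  Where \<open>\<Delta>\<^sub>\<infinity> w > k\<^sup>3/3 > 0\<close>, the function \<open>w\<close> grows at least like the profile. Comparison with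
  \<open>k \<theta>(|p - x|)\<close> from the centre \<open>x\<close> alone says nothing, because the profile is not smooth at its centre. If the growth
  were smaller, however, it would be smaller for all centres \<open>q\<close> near \<open>x\<close>, so that
  \<open>w(p) \<le> w(q) + k \<theta>(|p - q|)\<close> for all \<open>p\<close>, \<open>q\<close> near \<open>x\<close>. Then \<open>w\<close> is constant near \<open>x\<close>, which the
  test function \<open>0\<close> excludes.
\<close>
lemma radial_subsolution_nondegenerate:
  fixes x :: "real^'n::finite"
  assumes sub: "radial_subsolution \<Omega> f w" and cont: "continuous_on \<Omega> w" and "open \<Omega>"
    and ball: "cball x R \<subseteq> \<Omega>" and "R > 0" and "k > 0"
    and f: "\<And>p. p \<in> cball x R \<Longrightarrow> k ^ 3 / 3 < f p"
  shows "\<exists>p\<in>cball x R. k * aronsson_profile R \<le> w p - w x"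
proof (rule ccontr)
  assume "\<not> ?thesis"
  then have flat: "\<And>p. p \<in> cball x R \<Longrightarrow> w p - w x < k * aronsson_profile R" by force
  have contR: "continuous_on (cball x R) w" using cont ball by (rule continuous_on_subset)
  have "cball x R \<noteq> {}" using \<open>R > 0\<close> by auto
  then obtain pm where pm: "pm \<in> cball x R" "\<And>p. p \<in> cball x R \<Longrightarrow> w p \<le> w pm"
    using continuous_attains_sup[OF compact_cball _ contR] by blast
  \<comment> \<open>If \<open>\<Phi> q < 0\<close> and \<open>|q - x| < R\<close>, then \<open>w - k \<theta>(|p - q|)\<close> is smaller on the sphere \<open>|p - x| = R\<close> than at \<open>q\<close>.\<close>
  define \<Phi> where "\<Phi> = (\<lambda>q. w pm - w q - k * aronsson_profile (R - norm (q - x)))"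
  have x: "x \<in> \<Omega>" using ball \<open>R > 0\<close> by auto
  have "isCont w x" using cont \<open>open \<Omega>\<close> x by (simp add: continuous_on_eq_continuous_at)
  moreover have "isCont aronsson_profile R"
    using has_derivative_aronsson_profile[OF \<open>R > 0\<close>] by (rule DERIV_isCont)
  moreover have "isCont (\<lambda>q. R - norm (q - x)) x" by (intro isCont_diff isCont_norm) simp_all
  ultimately have "isCont (\<lambda>q. aronsson_profile (R - norm (q - x))) x"
    using isCont_o2[of x "\<lambda>q. R - norm (q - x)" aronsson_profile] by simp
  then have "isCont \<Phi> x" unfolding \<Phi>_def using \<open>isCont w x\<close>
    by (intro isCont_diff isCont_mult) simp_all
  moreover have "\<Phi> x < 0" using flat[OF pm(1)] by (simp add: \<Phi>_def)
  ultimately have "\<forall>\<^sub>F q in at x. \<Phi> q < 0"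
    unfolding isCont_def by (rule order_tendstoD)
  then obtain d0 where d0: "d0 > 0" "\<And>q. dist q x < d0 \<Longrightarrow> \<Phi> q < 0"
    unfolding eventually_at using \<open>\<Phi> x < 0\<close> by (metis UNIV_I)
  define d where "d = min d0 R"
  have d: "d > 0" "d \<le> d0" "d \<le> R" using d0 \<open>R > 0\<close> by (auto simp: d_def)
  have bound: "w p \<le> w q + k * aronsson_profile (norm (p - q))"
    if q: "q \<in> ball x d" and p: "p \<in> cball x R" for p q
  proof -
    let ?F = "\<lambda>p. w p - k * aronsson_profile (norm (p - q))"
    have "continuous_on (cball x R) ?F"
      by (intro continuous_intros contR continuous_on_compose2[OF continuous_on_aronsson_profile]) auto
    then obtain y where y: "y \<in> cball x R" "\<And>p. p \<in> cball x R \<Longrightarrow> ?F p \<le> ?F y"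
      using continuous_attains_sup[OF compact_cball _ \<open>continuous_on (cball x R) ?F\<close>] p by blast
    have qR: "norm (q - x) < R" and qd0: "dist q x < d0"
      using q d by (auto simp: dist_norm norm_minus_commute)
    then have "q \<in> cball x R" by (simp add: dist_norm norm_minus_commute)
    have yq: "y = q"
    proof (rule ccontr)
      assume "y \<noteq> q"
      show False
      proof (cases "norm (y - x) = R")
        case True
        have "norm (y - x) \<le> norm (y - q) + norm (q - x)"
          by (rule norm_diff_triangle_le[OF order_refl order_refl])
        then have "aronsson_profile (R - norm (q - x)) \<le> aronsson_profile (norm (y - q))"
          using True qR by (intro aronsson_profile_mono) auto
        then have "k * aronsson_profile (R - norm (q - x)) \<le> k * aronsson_profile (norm (y - q))"
          using \<open>k > 0\<close> by simp
        then have "?F y \<le> w pm - k * aronsson_profile (R - norm (q - x))" using pm(2)[OF y(1)] by simp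
        also have "\<dots> < w q" using d0(2)[OF qd0] by (simp add: \<Phi>_def)
        also have "\<dots> \<le> ?F y" using y(2)[OF \<open>q \<in> cball x R\<close>] by simp
        finally show False by simp
      next
        case False
        then have "y \<in> ball x R" using y(1) by (simp add: dist_norm norm_minus_commute)
        then have "\<forall>\<^sub>F p in nhds y. p \<in> ball x R" by (intro eventually_nhds_in_open) auto
        then have max: "local_max_at ?F y" unfolding local_max_at_def
          by (rule eventually_mono) (use y(2) in auto)
        have r: "0 < norm (y - q)" using \<open>y \<noteq> q\<close> by simp
        then have "\<forall>\<^sub>F r in nhds (norm (y - q)). r \<in> {0<..}"
          by (intro eventually_nhds_in_open) auto
        then have "\<forall>\<^sub>F r in nhds (norm (y - q)).
          ((\<lambda>r. k * aronsson_profile r) has_real_derivative k * r powr (1/3)) (at r)"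
          by (rule eventually_mono) (use has_derivative_scaled_profile(1)[where s = 0] in auto)
        moreover have "((\<lambda>r. k * r powr (1/3)) has_real_derivative
            k * (1/3 * norm (y - q) powr (- 2/3))) (at (norm (y - q)))"
          using has_derivative_scaled_profile(2)[of "norm (y - q)" 0 k] r by simp
        ultimately have "f y \<le> (k * norm (y - q) powr (1/3))\<^sup>2 * (k * (1/3 * norm (y - q) powr (- 2/3)))"
          using y(1) ball \<open>y \<noteq> q\<close> by (intro radial_test[OF sub _ _ max]) auto
        then show False using f[OF y(1)] unfolding aronsson_profile_ode[OF r] by simp
      qed
    qed
    then show ?thesis using y(2)[OF p] by simp
  qed
  \<comment> \<open>The growth \<open>|p - q|\<^bsup>4/3\<^esup>\<close> is superlinear, so the gradient vanishes near \<open>x\<close>.\<close>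
  have "(w has_derivative (\<lambda>h. 0)) (at q within ball x d)" if q: "q \<in> ball x d" for q
    unfolding has_derivative_iff_norm
  proof
    have lim: "((\<lambda>p. k * (3/4) * norm (p - q) powr (1/3)) \<longlongrightarrow> 0) (at q within ball x d)"
    proof -
      have "((\<lambda>p. norm (p - q)) \<longlongrightarrow> norm (q - q)) (at q within ball x d)"
        by (intro tendsto_intros)
      then have "((\<lambda>p. norm (p - q) powr (1/3)) \<longlongrightarrow> norm (q - q) powr (1/3)) (at q within ball x d)"
        by (rule tendsto_powr2) auto
      then show ?thesis by (intro tendsto_mult_right_zero) simp
    qed
    have "norm (w p - w q - 0) / norm (p - q) \<le> k * (3/4) * norm (p - q) powr (1/3)"
      if "p \<in> ball x d" "p \<noteq> q" for p
    proof -
      have n: "norm (p - q) > 0" using that by simp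
      have "\<bar>w p - w q\<bar> \<le> k * aronsson_profile (norm (p - q))"
        using bound[of q p] bound[of p q] that q d by (auto simp: norm_minus_commute)
      also have "\<dots> = k * (3/4) * (norm (p - q) powr (1/3) * norm (p - q) powr 1)"
        unfolding aronsson_profile_def powr_add[symmetric] by simp
      finally show ?thesis using n by (simp add: field_simps)
    qed
    then have "\<forall>\<^sub>F p in at q within ball x d.
        norm (norm (w p - w q - 0) / norm (p - q)) \<le> k * (3/4) * norm (p - q) powr (1/3)"
      by (auto simp: eventually_at intro!: exI[of _ 1])
    then show "((\<lambda>p. norm (w p - w q - 0) / norm (p - q)) \<longlongrightarrow> 0) (at q within ball x d)"
      by (rule Lim_null_comparison[OF _ lim])
  qed simp
  then obtain c where c: "\<And>q. q \<in> ball x d \<Longrightarrow> w q = c"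
    using has_derivative_zero_constant[OF convex_ball] by metis
  have "\<forall>\<^sub>F p in nhds x. p \<in> ball x d" using d by (intro eventually_nhds_in_open) auto
  then have "local_max_at (\<lambda>p. w p - (0 * norm (p - x) ^ 2 + 0 * norm (p - x) ^ 4)) x"
    unfolding local_max_at_def by (rule eventually_mono) (use c d in auto)
  then have "f x \<le> 0"
    using sub x unfolding radial_subsolution_def Let_def by fastforce
  moreover have "k ^ 3 / 3 < f x" using f[of x] \<open>R > 0\<close> by simp
  ultimately show False using \<open>k > 0\<close> zero_less_power[of k 3] by linarith
qed

text \<open>
  Comparison with \<open>r \<mapsto> k \<theta>(r + s)\<close>, whose graph is convex, for positive lower bounds of \<open>\<Delta>\<^sub>\<infinity> w\<close>.
\<close>
lemma radial_subsolution_profile_above: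
  fixes x :: "real^'n::finite"
  assumes sub: "radial_subsolution \<Omega> f w" and cont: "continuous_on \<Omega> w"
    and ball: "cball x R \<subseteq> \<Omega>" and "R > 0" "k > 0" "s \<ge> 0"
    and f: "\<And>p. p \<in> cball x R \<Longrightarrow> k ^ 3 / 3 < f p"
    and bd: "\<And>p. p \<in> cball x R \<Longrightarrow> w p - w x \<le> k * (aronsson_profile (R + s) - aronsson_profile s)"
    and q: "q \<in> cball x R"
  shows "w q - w x \<le> k * (aronsson_profile (norm (q - x) + s) - aronsson_profile s)"
proof -
  let ?H = "\<lambda>r. k * aronsson_profile (r + s)"
  have "w q - ?H (norm (q - x)) \<le> w x - k * aronsson_profile s"
  proof (rule radial_comparison[OF sub cont ball \<open>R > 0\<close> _ has_derivative_scaled_profile(1)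
        has_derivative_scaled_profile(2)])
    show "continuous_on {0..R} ?H" using \<open>s \<ge> 0\<close>
      by (intro continuous_intros continuous_on_compose2[OF continuous_on_aronsson_profile]) auto
  next
    fix p assume p: "p \<in> cball x R" "0 < norm (p - x)"
    have "0 < norm (p - x) + s" using p(2) \<open>s \<ge> 0\<close> by (rule add_pos_nonneg)
    from aronsson_profile_ode[OF this] f[OF p(1)]
    show "(k * (norm (p - x) + s) powr (1 / 3))\<^sup>2 * (k * (1 / 3 * (norm (p - x) + s) powr (- 2 / 3))) < f p"
      by simp
  next
    fix p assume "norm (p - x) = R"
    then have "p \<in> cball x R" by (simp add: dist_norm norm_minus_commute)
    from bd[OF this] show "w p - ?H R \<le> w x - k * aronsson_profile s" by (simp add: algebra_simps)
  qed (use \<open>s \<ge> 0\<close> q in auto)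
  then show ?thesis by (simp add: algebra_simps)
qed

text \<open>
  Comparison with \<open>r \<mapsto> - k \<theta>(R + s - r)\<close>, which is increasing and concave, for negative lower
  bounds of \<open>\<Delta>\<^sub>\<infinity> w\<close>.
\<close>
lemma radial_subsolution_profile_below:
  fixes x :: "real^'n::finite"
  assumes sub: "radial_subsolution \<Omega> f w" and cont: "continuous_on \<Omega> w"
    and ball: "cball x R \<subseteq> \<Omega>" and "R > 0" "k > 0" "s \<ge> 0"
    and f: "\<And>p. p \<in> cball x R \<Longrightarrow> - (k ^ 3 / 3) < f p"
    and bd: "\<And>p. p \<in> cball x R \<Longrightarrow> w p - w x \<le> k * (aronsson_profile (R + s) - aronsson_profile s)"
    and q: "q \<in> cball x R"
  shows "w q - w x \<le> k * (aronsson_profile (R + s) - aronsson_profile (R + s - norm (q - x)))"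
proof -
  let ?H = "\<lambda>r. - (k * aronsson_profile (R + s - r))"
  let ?H1 = "\<lambda>r. k * (R + s - r) powr (1 / 3)"
  let ?H2 = "\<lambda>r. - (k * (1 / 3 * (R + s - r) powr (- 2 / 3)))"
  have "w q - ?H (norm (q - x)) \<le> w x + k * aronsson_profile (R + s)"
  proof (rule radial_comparison[OF sub cont ball \<open>R > 0\<close>, where ?H1.0 = ?H1 and ?H2.0 = ?H2])
    show "continuous_on {0..R} ?H" using \<open>s \<ge> 0\<close>
      by (intro continuous_intros continuous_on_compose2[OF continuous_on_aronsson_profile]) auto
  next
    fix r assume r: "0 < r" "r < R"
    then have pos: "0 < R + s - r" using \<open>s \<ge> 0\<close> by simp
    have d: "((\<lambda>r. R + s - r) has_real_derivative - 1) (at r)" by (auto intro!: derivative_eq_intros)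
    show "(?H has_real_derivative ?H1 r) (at r)"
      using DERIV_minus[OF DERIV_cmult[OF DERIV_chain2[OF has_derivative_aronsson_profile[OF pos] d], of k]]
      by simp
    show "(?H1 has_real_derivative ?H2 r) (at r)"
      using DERIV_cmult[OF DERIV_chain2[OF has_derivative_aronsson_profile_deriv[OF pos] d], of k]
      by simp
  next
    fix p assume p: "p \<in> cball x R" "norm (p - x) < R"
    then have "0 < R + s - norm (p - x)" using \<open>s \<ge> 0\<close> by simp
    from aronsson_profile_ode[OF this, of k] f[OF p(1)]
    show "(?H1 (norm (p - x)))\<^sup>2 * ?H2 (norm (p - x)) < f p" by simp
  next
    fix p assume "norm (p - x) = R"
    then have "p \<in> cball x R" by (simp add: dist_norm norm_minus_commute)
    from bd[OF this] show "w p - ?H R \<le> w x + k * aronsson_profile (R + s)" by (simp add: algebra_simps)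
  qed (use q in auto)
  then show ?thesis by (simp add: algebra_simps)
qed

section \<open>The three-point argument and the comparison principle\<close>

text \<open>
  A pair \<open>(y, z)\<close> that maximizes \<open>u(y) - v(z)\<close> under \<open>|y - z| \<le> 2 e\<close> is compared with the
  pairs \<open>(y2, x)\<close> and \<open>(x, z2)\<close>, where \<open>y2\<close> and \<open>z2\<close> are extremal points for \<open>u\<close> and \<open>v\<close> on the ball of
  radius \<open>2 e\<close> about \<open>x\<close>.
\<close>
lemma three_point_contradiction:
  fixes x :: "real^'n::finite"
  assumes "open \<Omega>" and u: "radial_subsolution \<Omega> f u" "continuous_on \<Omega> u"
    and v: "radial_subsolution \<Omega> (\<lambda>x. - g x) (\<lambda>x. - v x)" "continuous_on \<Omega> v"
    and ball: "cball x (2 * e) \<subseteq> \<Omega>" and "e > 0" and kl: "0 < l" "l < k"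
    and f: "\<And>p. p \<in> cball x (2 * e) \<Longrightarrow> k ^ 3 / 3 < f p"
    and g: "\<And>p. p \<in> cball x (2 * e) \<Longrightarrow> g p < l ^ 3 / 3"
    and yz: "y \<in> cball x e" "z \<in> cball x e"
    and max: "\<And>p q. p \<in> cball x (2 * e) \<Longrightarrow> q \<in> cball x (2 * e) \<Longrightarrow> dist p q \<le> 2 * e \<Longrightarrow>
      u p - v q \<le> u y - v z"
  shows False
proof -
  let ?\<theta> = aronsson_profile
  let ?B = "cball x (2 * e)"
  have xB: "x \<in> ?B" and yB: "y \<in> ?B" and zB: "z \<in> ?B" and R: "2 * e > 0" using yz \<open>e > 0\<close> by auto
  have cu: "continuous_on ?B u" and cv: "continuous_on ?B v" and cv': "continuous_on \<Omega> (\<lambda>p. - v p)"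
    using u(2) v(2) ball continuous_on_subset by (auto intro: continuous_intros)
  obtain y2 where y2: "y2 \<in> ?B" "\<And>p. p \<in> ?B \<Longrightarrow> u p \<le> u y2"
    using continuous_attains_sup[OF compact_cball _ cu] xB by blast
  obtain z2 where z2: "z2 \<in> ?B" "\<And>p. p \<in> ?B \<Longrightarrow> v z2 \<le> v p"
    using continuous_attains_inf[OF compact_cball _ cv] xB by blast
  define P Q P' Q' where "P = u y - u x" and "Q = u y2 - u y" and "P' = v x - v z" and "Q' = v z - v z2"
  have "Q \<le> P'" using max[OF y2(1) xB] y2(1) by (simp add: Q_def P'_def dist_commute)
  have "Q' \<le> P" using max[OF xB z2(1)] z2(1) by (simp add: Q'_def P_def)
  obtain p where "p \<in> ?B" "k * ?\<theta> (2 * e) \<le> u p - u x"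
    using radial_subsolution_nondegenerate[OF u \<open>open \<Omega>\<close> ball R _ f] kl by auto
  then have "k * ?\<theta> (2 * e) \<le> P + Q" using y2(2) by (force simp: P_def Q_def)
  then obtain s where s: "s \<ge> 0" "P + Q = k * (?\<theta> (2 * e + s) - ?\<theta> s)"
    using aronsson_profile_increment_surj[of k "2 * e"] kl \<open>e > 0\<close> by auto
  have "u p - u x \<le> k * (?\<theta> (2 * e + s) - ?\<theta> s)" if "p \<in> ?B" for p
    using y2(2)[OF that] s(2) by (simp add: P_def Q_def)
  from radial_subsolution_profile_above[OF u ball R _ s(1) f this yB] kl
  have "P \<le> k * (?\<theta> (norm (y - x) + s) - ?\<theta> s)" by (simp add: P_def)
  also have "\<dots> \<le> k * (?\<theta> (e + s) - ?\<theta> s)"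
    using kl s(1) yz by (intro mult_left_mono diff_right_mono aronsson_profile_mono) (auto simp: dist_norm norm_minus_commute)
  finally have P: "P \<le> k * (?\<theta> (e + s) - ?\<theta> s)" .
  then have Q: "k * (?\<theta> (2 * e + s) - ?\<theta> (e + s)) \<le> Q" using s(2) by (simp add: algebra_simps)
  have v_step: "P' \<le> l * (?\<theta> (2 * e + t) - ?\<theta> (e + t))"
    if t: "t \<ge> 0" "P' + Q' \<le> l * (?\<theta> (2 * e + t) - ?\<theta> t)" for t
  proof -
    have bd: "- v p - - v x \<le> l * (?\<theta> (2 * e + t) - ?\<theta> t)" if "p \<in> ?B" for p
      using z2(2)[OF that] t(2) by (simp add: P'_def Q'_def)
    have "- (l ^ 3 / 3) < - g p" if "p \<in> ?B" for p using g[OF that] by simp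
    from radial_subsolution_profile_below[OF v(1) cv' ball R kl(1) t(1) this bd zB]
    have "P' \<le> l * (?\<theta> (2 * e + t) - ?\<theta> (2 * e + t - norm (z - x)))" by (simp add: P'_def)
    also have "\<dots> \<le> l * (?\<theta> (2 * e + t) - ?\<theta> (e + t))"
      using kl t(1) yz \<open>e > 0\<close> by (intro mult_left_mono diff_left_mono aronsson_profile_mono) (auto simp: dist_norm norm_minus_commute)
    finally show ?thesis .
  qed
  show False
  proof (cases "l * ?\<theta> (2 * e) \<le> P' + Q'")
    case True
    then obtain t where t: "t \<ge> 0" "P' + Q' = l * (?\<theta> (2 * e + t) - ?\<theta> t)"
      using aronsson_profile_increment_surj[of l "2 * e"] kl \<open>e > 0\<close> by auto
    have P': "P' \<le> l * (?\<theta> (2 * e + t) - ?\<theta> (e + t))" using v_step[OF t(1)] t(2) by simp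
    then have Q': "l * (?\<theta> (e + t) - ?\<theta> t) \<le> Q'" using t(2) by (simp add: algebra_simps)
    show False
      using aronsson_profile_increments_incompatible[OF kl \<open>e > 0\<close> s(1) t(1)] P P' Q Q'
        \<open>Q \<le> P'\<close> \<open>Q' \<le> P\<close> by linarith
  next
    \<comment> \<open>Here no shift matches \<open>P' + Q'\<close>, but the unshifted profile already bounds \<open>P'\<close> by less than \<open>Q\<close>.\<close>
    case False
    then have "P' \<le> l * (?\<theta> (2 * e) - ?\<theta> e)" using v_step[of 0] by simp
    also have "\<dots> \<le> l * (?\<theta> (2 * e + s) - ?\<theta> (e + s))"
      using aronsson_profile_increment_mono[of e e "e + s"] kl s(1) \<open>e > 0\<close>
      by (intro mult_left_mono) (auto simp: algebra_simps)
    also have "\<dots> < k * (?\<theta> (2 * e + s) - ?\<theta> (e + s))"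
      using kl s(1) \<open>e > 0\<close> aronsson_profile_strict_mono[of "e + s" "2 * e + s"]
      by (intro mult_strict_right_mono) auto
    finally show False using Q \<open>Q \<le> P'\<close> by linarith
  qed
qed

text \<open>
  The case \<open>f x0 > 0\<close> of the comparison principle, localized near \<open>x0\<close>.
\<close>
lemma no_maximal_pair_nearby:
  fixes x0 :: "real^'n::finite"
  assumes "open \<Omega>" and u: "radial_subsolution \<Omega> f u" "continuous_on \<Omega> u"
    and v: "radial_subsolution \<Omega> (\<lambda>x. - g x) (\<lambda>x. - v x)" "continuous_on \<Omega> v"
    and fg: "continuous_on \<Omega> f" "continuous_on \<Omega> g"
    and x0: "x0 \<in> \<Omega>" "g x0 < f x0" "0 < f x0"
  shows "\<exists>\<rho>>0. \<forall>e y z. 0 < e \<longrightarrow> e < \<rho> \<longrightarrow> dist y x0 < \<rho> \<longrightarrow> dist z x0 < \<rho> \<longrightarrow> dist y z \<le> 2 * e \<longrightarrow>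
    \<not> (\<forall>p\<in>\<Omega>. \<forall>q\<in>\<Omega>. dist p q \<le> 2 * e \<longrightarrow> u p - v q \<le> u y - v z)"
proof -
  have "max (g x0) 0 < f x0" using x0 by simp
  then obtain c' where c': "max (g x0) 0 < c'" "c' < f x0" using dense by blast
  then obtain c where c: "c' < c" "c < f x0" using dense by blast
  \<comment> \<open>The constants are chosen so that \<open>k\<^sup>3/3\<close> and \<open>l\<^sup>3/3\<close> separate \<open>f\<close> and \<open>g\<close> near \<open>x0\<close>.\<close>
  define k where "k = root 3 (3 * c)"
  define l where "l = root 3 (3 * c')"
  have kl: "0 < l" "l < k" using c c' by (auto simp: k_def l_def)
  have kl3: "k ^ 3 / 3 = c" "l ^ 3 / 3 = c'" using c c' by (auto simp: k_def l_def)
  have "(f \<longlongrightarrow> f x0) (nhds x0)" "(g \<longlongrightarrow> g x0) (nhds x0)"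
    using fg x0(1) \<open>open \<Omega>\<close> by (auto simp: continuous_on_eq_continuous_at isCont_def tendsto_nhds_iff)
  then have "\<forall>\<^sub>F p in nhds x0. c < f p" "\<forall>\<^sub>F p in nhds x0. g p < c'"
    using c c' by (auto intro: order_tendstoD)
  moreover have "\<forall>\<^sub>F p in nhds x0. p \<in> \<Omega>" using \<open>open \<Omega>\<close> x0(1) by (rule eventually_nhds_in_open)
  ultimately have "\<forall>\<^sub>F p in nhds x0. c < f p \<and> g p < c' \<and> p \<in> \<Omega>" by eventually_elim auto
  then obtain d where d: "d > 0" "\<And>p. dist p x0 < d \<Longrightarrow> c < f p \<and> g p < c' \<and> p \<in> \<Omega>"
    unfolding eventually_nhds_metric by blast
  have False
    if e: "0 < e" "e < d / 4" and y: "dist y x0 < d / 4" and z: "dist z x0 < d / 4"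
      and yz: "dist y z \<le> 2 * e"
      and max: "\<And>p q. p \<in> \<Omega> \<Longrightarrow> q \<in> \<Omega> \<Longrightarrow> dist p q \<le> 2 * e \<Longrightarrow> u p - v q \<le> u y - v z" for e y z
  proof -
    define x where "x = midpoint y z"
    have "dist x y \<le> e" "dist x z \<le> e" using yz by (auto simp: x_def dist_midpoint)
    have near: "dist p x0 < d" if "p \<in> cball x (2 * e)" for p
    proof -
      have "dist p x0 \<le> dist p x + dist x y + dist y x0"
        by (smt (verit) dist_triangle)
      then show ?thesis using that e y \<open>dist x y \<le> e\<close> by (simp add: dist_commute)
    qed
    show False
    proof (rule three_point_contradiction[OF \<open>open \<Omega>\<close> u v _ e(1) kl])
      show "cball x (2 * e) \<subseteq> \<Omega>" using near d(2) by blast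
      show "k ^ 3 / 3 < f p" "g p < l ^ 3 / 3" if "p \<in> cball x (2 * e)" for p
        using d(2)[OF near[OF that]] by (auto simp: kl3)
      show "y \<in> cball x e" "z \<in> cball x e" using \<open>dist x y \<le> e\<close> \<open>dist x z \<le> e\<close> by auto
      show "u p - v q \<le> u y - v z"
        if "p \<in> cball x (2 * e)" "q \<in> cball x (2 * e)" "dist p q \<le> 2 * e" for p q
        using max d(2) near that by blast
    qed
  qed
  then show ?thesis using d(1) by (intro exI[of _ "d / 4"]) (auto, blast)
qed

text \<open>
  Strict inequality between the right-hand sides is required only where the conclusion would fail.
\<close>
theorem radial_comparison_principle:
  fixes \<Omega> :: "(real^'n::finite) set"
  assumes "open \<Omega>" "bounded \<Omega>"
    and u: "radial_subsolution \<Omega> f u" "continuous_on (closure \<Omega>) u"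
    and v: "radial_subsolution \<Omega> (\<lambda>x. - g x) (\<lambda>x. - v x)" "continuous_on (closure \<Omega>) v"
    and fg: "continuous_on \<Omega> f" "continuous_on \<Omega> g"
    and bdry: "\<And>x. x \<in> frontier \<Omega> \<Longrightarrow> u x \<le> v x"
    and strict: "\<And>x. x \<in> \<Omega> \<Longrightarrow> v x < u x \<Longrightarrow> g x < f x"
    and x: "x \<in> \<Omega>"
  shows "u x \<le> v x"
proof (rule ccontr)
  assume "\<not> u x \<le> v x"
  let ?K = "closure \<Omega>"
  have sub: "\<Omega> \<subseteq> ?K" by (rule closure_subset)
  have K: "compact ?K" using \<open>bounded \<Omega>\<close> by (rule compact_closure[THEN iffD2])
  define S where "S = (\<lambda>n::nat. {w \<in> ?K \<times> ?K. dist (fst w) (snd w) \<le> 2 * inverse (real (Suc n))})"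
  have ex: "\<exists>w\<in>S n. \<forall>w'\<in>S n. u (fst w') - v (snd w') \<le> u (fst w) - v (snd w)" for n
  proof (rule continuous_attains_sup)
    have "S n = (?K \<times> ?K) \<inter> {w. dist (fst w) (snd w) \<le> 2 * inverse (real (Suc n))}"
      by (auto simp: S_def)
    moreover have "closed {w :: (real^'n) \<times> (real^'n). dist (fst w) (snd w) \<le> 2 * inverse (real (Suc n))}"
      by (intro closed_Collect_le continuous_intros)
    ultimately show "compact (S n)" using compact_Times[OF K K] by (simp add: compact_Int_closed)
    have "(x, x) \<in> S n" using x sub by (auto simp: S_def)
    then show "S n \<noteq> {}" by blast
    show "continuous_on (S n) (\<lambda>w. u (fst w) - v (snd w))"
      by (intro continuous_intros continuous_on_compose2[OF u(2)] continuous_on_compose2[OF v(2)])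
         (auto simp: S_def)
  qed
  then obtain W where W: "\<And>n. W n \<in> S n"
    and Wmax: "\<And>n w'. w' \<in> S n \<Longrightarrow> u (fst w') - v (snd w') \<le> u (fst (W n)) - v (snd (W n))"
    by metis
  have "\<forall>n. W n \<in> ?K \<times> ?K" using W by (auto simp: S_def)
  then obtain w r where w: "w \<in> ?K \<times> ?K" and r: "strict_mono r" and lim: "(W \<circ> r) \<longlonglongrightarrow> w"
    using compact_Times[OF K K] unfolding compact_def by blast
  define y z where "y = (\<lambda>n. fst (W (r n)))" and "z = (\<lambda>n. snd (W (r n)))"
  define e where "e = (\<lambda>n. inverse (real (Suc (r n))))"
  have yz: "y n \<in> ?K" "z n \<in> ?K" "dist (y n) (z n) \<le> 2 * e n" for n
    using W[of "r n"] by (auto simp: S_def y_def z_def e_def)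
  have e0: "e \<longlonglongrightarrow> 0" "e n > 0" for n
    using LIMSEQ_subseq_LIMSEQ[OF LIMSEQ_inverse_real_of_nat r] by (auto simp: e_def o_def)
  define x0 where "x0 = fst w"
  have yl: "y \<longlonglongrightarrow> x0" using tendsto_fst[OF lim] by (simp add: y_def x0_def o_def)
  have zl: "z \<longlonglongrightarrow> snd w" using tendsto_snd[OF lim] by (simp add: z_def o_def)
  have "(\<lambda>n. dist (y n) (z n)) \<longlonglongrightarrow> dist x0 (snd w)" using yl zl by (rule tendsto_dist)
  moreover have "(\<lambda>n. dist (y n) (z n)) \<longlonglongrightarrow> 0"
  proof (rule tendsto_sandwich[OF _ _ tendsto_const])
    show "(\<lambda>n. 2 * e n) \<longlonglongrightarrow> 0" using tendsto_mult_right_zero[OF e0(1)] by simp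
  qed (use yz in auto)
  ultimately have "dist x0 (snd w) = 0" by (rule LIMSEQ_unique)
  then have zl: "z \<longlonglongrightarrow> x0" using zl by simp
  have x0K: "x0 \<in> ?K" using w by (auto simp: x0_def)
  have "(\<lambda>n. u (y n) - v (z n)) \<longlonglongrightarrow> u x0 - v x0"
    using yl zl yz x0K
    by (intro tendsto_intros continuous_on_tendsto_compose[OF u(2)] continuous_on_tendsto_compose[OF v(2)]) auto
  moreover have "u x - v x \<le> u (y n) - v (z n)" for n
    using Wmax[of "(x, x)" "r n"] x sub by (auto simp: S_def y_def z_def)
  ultimately have "u x - v x \<le> u x0 - v x0" by (intro LIMSEQ_le_const) auto
  with \<open>\<not> u x \<le> v x\<close> have gt: "v x0 < u x0" by simp
  then have x0: "x0 \<in> \<Omega>" using bdry[of x0] x0K interior_open[OF \<open>open \<Omega>\<close>]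
    by (force simp: frontier_def)
  have maxpair: "u p - v q \<le> u (y n) - v (z n)" if "p \<in> \<Omega>" "q \<in> \<Omega>" "dist p q \<le> 2 * e n" for p q n
    using Wmax[of "(p, q)" "r n"] that sub by (auto simp: S_def y_def z_def e_def)
  have cu: "continuous_on \<Omega> u" and cv: "continuous_on \<Omega> v"
    using u(2) v(2) sub continuous_on_subset by blast+
  have close: "\<exists>n. e n < \<rho> \<and> dist (y n) x0 < \<rho> \<and> dist (z n) x0 < \<rho>" if "\<rho> > 0" for \<rho>
  proof -
    have "\<forall>\<^sub>F n in sequentially. e n < \<rho> \<and> dist (y n) x0 < \<rho> \<and> dist (z n) x0 < \<rho>"
      using that by (intro eventually_conj order_tendstoD[OF e0(1)] tendstoD[OF yl] tendstoD[OF zl])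
    then show ?thesis by (auto simp: eventually_sequentially)
  qed
  have "g x0 < f x0" using strict[OF x0 gt] .
  then consider "0 < f x0" | "g x0 < 0" by linarith
  then show False
  proof cases
    case 1
    obtain \<rho> where "\<rho> > 0" and \<rho>: "\<And>e y z. 0 < e \<Longrightarrow> e < \<rho> \<Longrightarrow> dist y x0 < \<rho> \<Longrightarrow> dist z x0 < \<rho> \<Longrightarrow>
        dist y z \<le> 2 * e \<Longrightarrow> \<not> (\<forall>p\<in>\<Omega>. \<forall>q\<in>\<Omega>. dist p q \<le> 2 * e \<longrightarrow> u p - v q \<le> u y - v z)"
      using no_maximal_pair_nearby[OF \<open>open \<Omega>\<close> u(1) cu v(1) cv fg x0 \<open>g x0 < f x0\<close> 1] by metis
    obtain n where "e n < \<rho>" "dist (y n) x0 < \<rho>" "dist (z n) x0 < \<rho>" using close[OF \<open>\<rho> > 0\<close>] by blast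
    from \<rho>[OF e0(2) this yz(3)] maxpair show False by blast
  next
    case 2
    \<comment> \<open>Exchange the roles: \<open>(z n, y n)\<close> is a maximizing pair for \<open>(-v, -u)\<close>, and \<open>-g x0 > 0\<close>.\<close>
    have u': "radial_subsolution \<Omega> (\<lambda>x. - (- f x)) (\<lambda>x. - (- u x))" using u(1) by simp
    have cont: "continuous_on \<Omega> (\<lambda>x. - v x)" "continuous_on \<Omega> (\<lambda>x. - u x)"
      "continuous_on \<Omega> (\<lambda>x. - g x)" "continuous_on \<Omega> (\<lambda>x. - f x)"
      using cu cv fg by (auto intro: continuous_intros)
    obtain \<rho> where "\<rho> > 0" and \<rho>: "\<And>e y z. 0 < e \<Longrightarrow> e < \<rho> \<Longrightarrow> dist y x0 < \<rho> \<Longrightarrow> dist z x0 < \<rho> \<Longrightarrow>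
        dist y z \<le> 2 * e \<Longrightarrow> \<not> (\<forall>p\<in>\<Omega>. \<forall>q\<in>\<Omega>. dist p q \<le> 2 * e \<longrightarrow> - v p - - u q \<le> - v y - - u z)"
      using no_maximal_pair_nearby[OF \<open>open \<Omega>\<close> v(1) cont(1) u' cont(2-4) x0] \<open>g x0 < f x0\<close> 2 by auto
    obtain n where n: "e n < \<rho>" "dist (z n) x0 < \<rho>" "dist (y n) x0 < \<rho>" using close[OF \<open>\<rho> > 0\<close>] by blast
    have "- v p - - u q \<le> - v (z n) - - u (y n)" if "p \<in> \<Omega>" "q \<in> \<Omega>" "dist p q \<le> 2 * e n" for p q
      using maxpair[OF that(2,1)] that(3) by (simp add: dist_commute)
    then show False using \<rho>[OF e0(2) n] yz(3)[of n] by (auto simp: dist_commute)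
  qed
qed

section \<open>Uniqueness\<close>

theorem viscosity_solutions_comparison:
  fixes \<Omega> :: "(real^'n::finite) set"
  assumes "open \<Omega>" "bounded \<Omega>"
    and h: "continuous_on \<Omega> h" and a: "continuous_on \<Omega> a" "\<And>x. x \<in> \<Omega> \<Longrightarrow> a x \<ge> 0" and "0 < m"
    and u: "continuous_on (closure \<Omega>) u" "viscosity_subsolution \<Omega> a m h u"
    and v: "continuous_on (closure \<Omega>) v" "viscosity_supersolution \<Omega> a m h v"
    and v_nonneg: "\<And>x. x \<in> \<Omega> \<Longrightarrow> v x \<ge> 0"
    and bdry: "\<And>x. x \<in> frontier \<Omega> \<Longrightarrow> u x \<le> v x"
    and zeros: "\<And>x. x \<in> \<Omega> \<Longrightarrow> a x = 0 \<Longrightarrow> u x \<le> v x"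
    and x: "x \<in> \<Omega>"
  shows "u x \<le> v x"
proof (rule radial_comparison_principle[OF \<open>open \<Omega>\<close> \<open>bounded \<Omega>\<close>
      viscosity_subsolution_imp_radial[OF u(2)] u(1)
      viscosity_supersolution_imp_radial[OF v(2)] v(1) _ _ bdry _ x])
  have rhs: "continuous_on \<Omega> (\<lambda>x. a x * max (w x) 0 powr m + h x)"
    if "continuous_on (closure \<Omega>) w" for w
  proof -
    have "continuous_on \<Omega> w" using that closure_subset by (rule continuous_on_subset)
    then show ?thesis using \<open>0 < m\<close> by (intro continuous_intros continuous_on_powr' a h) auto
  qed
  show "continuous_on \<Omega> (\<lambda>x. a x * max (u x) 0 powr m + h x)" using u(1) by (rule rhs)
  show "continuous_on \<Omega> (\<lambda>x. a x * max (v x) 0 powr m + h x)" using v(1) by (rule rhs)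
  fix y assume y: "y \<in> \<Omega>" "v y < u y"
  then have "a y > 0" using a(2)[of y] zeros[of y] by fastforce
  moreover have "max (v y) 0 powr m < max (u y) 0 powr m"
    using y v_nonneg[of y] \<open>0 < m\<close> by (intro powr_less_mono2) auto
  ultimately show "a y * max (v y) 0 powr m + h y < a y * max (u y) 0 powr m + h y" by simp
qed

theorem corollary3p3:
  fixes \<Omega> :: "(real^'n::finite) set"
    and h a g u v :: "real^'n \<Rightarrow> real"
    and m :: real
  assumes "CARD('n) \<ge> 2"
    and "open \<Omega>" "connected \<Omega>" "\<Omega> \<noteq> {}" "bounded \<Omega>"
    and "continuous_on \<Omega> h" "Linfty_on \<Omega> h" "\<forall>x\<in>\<Omega>. h x \<le> 0"
    and "continuous_on \<Omega> a" "\<forall>x\<in>\<Omega>. a x \<ge> 0"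
    and "0 < m" "m < 3"
    and "continuous_on (frontier \<Omega>) g" "\<forall>x\<in>frontier \<Omega>. g x \<ge> 0"
    and "continuous_on (closure \<Omega>) u" "\<forall>x\<in>closure \<Omega>. u x \<ge> 0"
    and "viscosity_solution \<Omega> a m h u" "\<forall>x\<in>frontier \<Omega>. u x = g x"
    and "continuous_on (closure \<Omega>) v" "\<forall>x\<in>closure \<Omega>. v x \<ge> 0"
    and "viscosity_solution \<Omega> a m h v" "\<forall>x\<in>frontier \<Omega>. v x = g x"
    and "\<forall>x\<in>{x\<in>\<Omega>. a x = 0}. u x = v x"
  shows "\<forall>x\<in>\<Omega>. u x = v x"
proof
  fix x assume x: "x \<in> \<Omega>"
  note sub = closure_subset[of \<Omega>, THEN subsetD]
  have "u x \<le> v x"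
    by (rule viscosity_solutions_comparison[of \<Omega> h a m])
       (use assms x sub in \<open>auto simp: viscosity_solution_def\<close>)
  moreover have "v x \<le> u x"
    by (rule viscosity_solutions_comparison[of \<Omega> h a m])
       (use assms x sub in \<open>auto simp: viscosity_solution_def\<close>)
  ultimately show "u x = v x" by simp
qed

end
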